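(* Let $\mathbb{A}_1,\mathbb{A}_2\in\mathbb{R}^{n\times n}$ be symmetric, let $\mathcal{P}\subset\mathbb{R}^d$ be a compact parameter set, let $\theta_1,\theta_2:\mathcal{P}\to\mathbb{R}$, and assume that $\mathbb{A}(\mu)=\theta_1(\mu)\mathbb{A}_1+\theta_2(\mu)\mathbb{A}_2$ is symmetric positive-definite for every $\mu\in\mathcal{P}$. Let $\mathbf{f}\in\mathbb{R}^n$ and let $\mathbf{u}_\mu\in\mathbb{R}^n$ be the solution of $\mathbb{A}(\mu)\mathbf{u}_\mu=\mathbf{f}$. Let $\mu_0,\mu_1\in\mathcal{P}$, $\mathbb{B}=\mathbb{A}(\mu_0)^{-1}$, $\kappa(\mu)=\kappa(\mathbb{B}\mathbb{A}(\mu))$, and let $m>0$ be an integer. Assume \[ \theta_1(\mu_0)\theta_2(\mu_1)-\theta_2(\mu_0)\theta_1(\mu_1)\neq0 . \] Then for any $\mu\in\mathcal{P}$ with $\theta_1(\mu_0)\theta_2(\mu)-\theta_2(\mu_0)\theta_1(\mu)\neq0$, the reduced basis solution $\hat{\mathbf{u}}_\mu$ produced by the algorithm $\mathrm{RCGBM}(\mathbb{B},\mathcal{P},\mu_0,\mu_1,m)$ satisfies \[ \|\mathbf{u}_\mu-\hat{\mathbf{u}}_\mu\|_{\mathbb{A}(\mu)}\leq 2\left(\frac{\sqrt{\kappa(\mu)}-1}{\sqrt{\kappa(\mu)}+1}\right)^{m}\|\mathbf{u}_\mu\|_{\mathbb{A}(\mu)} . \]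
   Context: $(\cdot,\cdot)$ and $\|\cdot\|$ are the Euclidean inner product and norm on $\mathbb{R}^n$. For a symmetric positive-definite matrix $\mathbb{C}$, $\|\mathbf{v}\|_{\mathbb{C}}:=\sqrt{(\mathbb{C}\mathbf{v},\mathbf{v})}$. The condition number $\kappa(\mathbb{B}\mathbb{A}(\mu))$ is the ratio of the largest to the smallest eigenvalue of $\mathbb{B}\mathbb{A}(\mu)$ (these eigenvalues are real and positive). The algorithm $\mathrm{RCGBM}(\mathbb{B},\mathcal{P},\mu_0,\mu_1,m)$ (Reduced Conjugate Gradient Basis Method) is as follows. Offline stage: set $\mathbf{u}_0=\mathbf{0}$, $\mathbf{r}_0=\mathbf{f}$, $\mathbf{p}_0=\mathbf{z}_0=\mathbb{B}\mathbf{r}_0$. For $k=1,\ldots,m-1$ set $\alpha_k=(\mathbf{r}_{k-1},\mathbf{z}_{k-1})/(\mathbb{A}(\mu_1)\mathbf{p}_{k-1},\mathbf{p}_{k-1})$, $\mathbf{u}_k=\mathbf{u}_{k-1}+\alpha_k\mathbf{p}_{k-1}$, $\mathbf{r}_k=\mathbf{r}_{k-1}-\alpha_k\mathbb{A}(\mu_1)\mathbf{p}_{k-1}$, $\mathbf{z}_k=\mathbb{B}\mathbf{r}_k$, $\beta_k=(\mathbf{r}_k,\mathbf{z}_k)/(\mathbf{r}_{k-1},\mathbf{z}_{k-1})$, $\mathbf{p}_k=\mathbf{z}_k+\beta_k\mathbf{p}_{k-1}$. Set $\mathcal{K}_m:=\mathrm{Span}\{\mathbf{p}_0,\ldots,\mathbf{p}_{m-1}\}$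 and $\mathbb{P}:=\left[\mathbf{p}_0/\|\mathbf{p}_0\|,\ldots,\mathbf{p}_{m-1}/\|\mathbf{p}_{m-1}\|\right]$. Online stage: for each $\mu\in\mathcal{P}$, $\hat{\mathbf{u}}_\mu\in\mathcal{K}_m$ is determined by $(\mathbb{A}(\mu)\hat{\mathbf{u}}_\mu,\mathbf{v})=(\mathbf{f},\mathbf{v})$ for all $\mathbf{v}\in\mathcal{K}_m$; equivalently $\hat{\mathbf{u}}_\mu=\mathbb{P}(\mathbb{P}^t\mathbb{A}(\mu)\mathbb{P})^{-1}\mathbb{P}^t\mathbf{f}$. The algorithm is understood to be well defined, i.e. it runs without division by zero ($\mathbf{p}_0,\ldots,\mathbf{p}_{m-1}$ are nonzero). *)

theory Defs
  imports "HOL-Analysis.Analysis"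
begin

definition symmetric :: "real^'n^'n \<Rightarrow> bool" where
  "symmetric C \<longleftrightarrow> transpose C = C"

definition spd :: "real^'n^'n \<Rightarrow> bool" where
  "spd C \<longleftrightarrow> symmetric C \<and> (\<forall>v. v \<noteq> 0 \<longrightarrow> (C *v v) \<bullet> v > 0)"

definition energy_norm :: "real^'n^'n \<Rightarrow> real^'n \<Rightarrow> real" where
  "energy_norm C v = sqrt ((C *v v) \<bullet> v)"

text \<open>Only real eigenvalues are collected. This loses nothing for the condition number below,
  which is used for products of two symmetric positive-definite matrices: all complex eigenvalues
  of such a product are real and positive.\<close>

definition eigenvalues :: "real^'n^'n \<Rightarrow> real set" where
  "eigenvalues M = {c. \<exists>v. v \<noteq> 0 \<and> M *v v = c *\<^sub>R v}"

definition condition_number :: "real^'n^'n \<Rightarrow> real" where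
  "condition_number M = Max (eigenvalues M) / Min (eigenvalues M)"

record ('n) cg_state =
  approx :: "real^'n"
  resid :: "real^'n"
  precond_resid :: "real^'n"
  direction :: "real^'n"

text \<open>One step of the preconditioned conjugate gradient method for \<open>M u = f\<close> with
  preconditioner \<open>B\<close>; the fields are $u_k$, $r_k$, $z_k$, $p_k$.\<close>

definition pcg_step :: "real^'n^'n \<Rightarrow> real^'n^'n \<Rightarrow> ('n::finite) cg_state \<Rightarrow> 'n cg_state" where
  "pcg_step M B s =
    (let u = approx s; r = resid s; z = precond_resid s; p = direction s;
         \<alpha> = (r \<bullet> z) / ((M *v p) \<bullet> p);
         u' = u + \<alpha> *\<^sub>R p;
         r' = r - \<alpha> *\<^sub>R (M *v p);
         z' = B *v r';
         \<beta> = (r' \<bullet> z') / (r \<bullet> z);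
         p' = z' + \<beta> *\<^sub>R p
     in \<lparr>approx = u', resid = r', precond_resid = z', direction = p'\<rparr>)"

primrec pcg :: "real^'n^'n \<Rightarrow> real^'n^'n \<Rightarrow> real^'n \<Rightarrow> nat \<Rightarrow> ('n::finite) cg_state" where
  "pcg M B f 0 = \<lparr>approx = 0, resid = f, precond_resid = B *v f, direction = B *v f\<rparr>"
| "pcg M B f (Suc k) = pcg_step M B (pcg M B f k)"

definition reduced_space :: "real^'n^'n \<Rightarrow> real^'n^'n \<Rightarrow> real^'n \<Rightarrow> nat \<Rightarrow> (real^'n) set" where
  "reduced_space M B f m = span ((\<lambda>k. direction (pcg M B f k)) ` {..<m})"

definition galerkin_solution :: "real^'n^'n \<Rightarrow> real^'n \<Rightarrow> (real^'n) set \<Rightarrow> real^'n \<Rightarrow> bool" where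
  "galerkin_solution C f K w \<longleftrightarrow> w \<in> K \<and> (\<forall>v\<in>K. (C *v w) \<bullet> v = f \<bullet> v)"

lemma galerkin_solution_ex1:
  fixes C :: "real^'n^'n"
  assumes "spd C" and K: "subspace K"
  shows "\<exists>!w. galerkin_solution C f K w"
proof -
  let ?W = "(*v) C ` K"
  let ?O = "{y. \<forall>x\<in>K. orthogonal x y}"
  have pos: "v = 0" if "(C *v v) \<bullet> v = 0" for v
    using assms(1) that unfolding spd_def by fastforce
  have inj: "inj_on ((*v) C) UNIV"
  proof (rule inj_onI)
    fix x y assume "C *v x = C *v y"
    then have "(C *v (x - y)) \<bullet> (x - y) = 0" by (simp add: matrix_vector_mult_diff_distrib)
    then show "x = y" using pos[of "x - y"] by simp
  qed
  have W: "subspace ?W"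
    by (rule linear_subspace_image[OF matrix_vector_mul_linear K])
  have O: "subspace ?O"
    by (auto simp: subspace_def orthogonal_def inner_add_right)
  have "?W \<inter> ?O \<subseteq> {0}"
  proof clarify
    fix v assume "v \<in> K" "\<forall>x\<in>K. orthogonal x (C *v v)"
    then have "v = 0" by (intro pos) (auto simp: orthogonal_def inner_commute)
    then show "C *v v = 0" by simp
  qed
  then have "?W \<inter> ?O = {0}"
    using subspace_0[OF W] subspace_0[OF O] by blast
  moreover have "dim ?W = dim K"
    by (rule dim_image_eq[OF matrix_vector_mul_linear]) (use inj in \<open>auto intro: inj_on_subset\<close>)
  moreover have "dim ?O + dim K = DIM(real^'n)"
    using dim_subspace_orthogonal_to_vectors[OF K subspace_UNIV] by simp
  ultimately have "dim {x + y |x y. x \<in> ?W \<and> y \<in> ?O} = DIM(real^'n)"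
    using dim_sums_Int[OF W O] by simp
  then have "{x + y |x y. x \<in> ?W \<and> y \<in> ?O} = UNIV"
    unfolding dim_eq_full using span_eq_iff[THEN iffD2, OF subspace_sums[OF W O]] by simp
  then have "f \<in> {x + y |x y. x \<in> ?W \<and> y \<in> ?O}" by simp
  then obtain w y where wy: "w \<in> K" "y \<in> ?O" "f = C *v w + y"
    by blast
  then have "galerkin_solution C f K w"
    by (auto simp: galerkin_solution_def orthogonal_def inner_add_left inner_commute[of y])
  moreover have "w1 = w2" if g: "galerkin_solution C f K w1" "galerkin_solution C f K w2" for w1 w2
  proof -
    have "w1 - w2 \<in> K"
      using g subspace_diff[OF K] by (auto simp: galerkin_solution_def)
    then have "(C *v (w1 - w2)) \<bullet> (w1 - w2) = 0"
      using g by (simp add: galerkin_solution_def matrix_vector_mult_diff_distrib inner_diff_left)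
    then show ?thesis using pos by force
  qed
  ultimately show ?thesis by blast
qed

text \<open>The output of RCGBM for the parameter \<open>\<mu>\<close>, given the preconditioner \<open>B\<close>, the
  offline parameter \<open>\<mu>1\<close> and the dimension \<open>m\<close>. Its description is proper by
  \<open>galerkin_solution_ex1\<close> when \<open>A \<mu>\<close> is positive definite.\<close>

definition rcgbm ::
    "('p \<Rightarrow> real^'n^'n) \<Rightarrow> real^'n \<Rightarrow> real^'n^'n \<Rightarrow> 'p \<Rightarrow> nat \<Rightarrow> 'p \<Rightarrow> real^'n" where
  "rcgbm A f B \<mu>1 m \<mu> = (THE w. galerkin_solution (A \<mu>) f (reduced_space (A \<mu>1) B f m) w)"

text \<open>Nonzero directions $p_0,\dots,p_{m-1}$ rule out every division by zero when \<open>M\<close> and \<open>B\<close>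
  are positive definite: $r_k = 0$ would give $z_k = 0$, hence $p_k = 0$.\<close>

definition pcg_well_defined :: "real^'n^'n \<Rightarrow> real^'n^'n \<Rightarrow> real^'n \<Rightarrow> nat \<Rightarrow> bool" where
  "pcg_well_defined M B f m \<longleftrightarrow> (\<forall>k<m. direction (pcg M B f k) \<noteq> 0)"

end

theory Submission
  imports Defs "HOL-Computational_Algebra.Polynomial"
begin

text \<open>Since \<open>A \<mu>\<close> is a linear combination of \<open>A \<mu>0\<close> and \<open>A \<mu>1\<close>, the operator \<open>B A(\<mu>)\<close> is an
  affine function of \<open>B A(\<mu>1)\<close>. As long as the search directions do not vanish, \<open>B A(\<mu>1)\<close> maps
  the span of the first \<open>d\<close> directions into the span of the first \<open>d + 1\<close>, so the offline space
  contains \<open>q (B A(\<mu>)) B f\<close> for every polynomial \<open>q\<close> of degree less than \<open>m\<close>. By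
  optimality of the Galerkin projection, the energy norm of the reduced basis error is at most that
  of \<open>p (B A(\<mu>)) u\<close>, for every \<open>p\<close> of degree at most \<open>m\<close> with \<open>p(0) = 1\<close>.
  As \<open>B A(\<mu>)\<close> is self-adjoint for the energy inner product, it suffices to bound \<open>p\<close> on the spectrum, which is done by a rescaled Chebyshev polynomial.\<close>

section \<open>Chebyshev polynomials\<close>

fun chebyshev :: "nat \<Rightarrow> real poly" where
  "chebyshev 0 = 1"
| "chebyshev (Suc 0) = [:0, 1:]"
| "chebyshev (Suc (Suc n)) = [:0, 2:] * chebyshev (Suc n) - chebyshev n"

lemma degree_chebyshev_le: "degree (chebyshev n) \<le> n"
proof (induction n rule: chebyshev.induct)
  case (3 n)
  have "degree ([:0, 2:] * chebyshev (Suc n)) \<le> Suc (Suc n)"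
    using degree_mult_le[of "[:0, 2:]" "chebyshev (Suc n)"] 3 by simp
  then show ?case
    using 3 by (auto intro!: degree_diff_le)
qed auto

lemma poly_chebyshev_cos: "poly (chebyshev n) (cos t) = cos (real n * t)"
proof (induction n rule: chebyshev.induct)
  case (3 n)
  have "cos (real (Suc (Suc n)) * t) + cos (real n * t) = 2 * cos t * cos (real (Suc n) * t)"
    using cos_plus_cos[of "real (Suc (Suc n)) * t" "real n * t"]
    by (simp add: algebra_simps add_divide_distrib)
  then show ?case
    using 3 by (simp add: algebra_simps)
qed auto

lemma abs_poly_chebyshev_le_1:
  assumes "\<bar>x\<bar> \<le> 1"
  shows "\<bar>poly (chebyshev n) x\<bar> \<le> 1"
proof -
  have "x = cos (arccos x)"
    using assms by (simp add: abs_le_iff)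
  then have "poly (chebyshev n) x = cos (real n * arccos x)"
    by (metis poly_chebyshev_cos)
  then show ?thesis by simp
qed

text \<open>The cosine identity with exp(i t) replaced by a real \<open>y\<close>: it gives the
  values outside the open interval (-1, 1), where the polynomials grow like \<open>y ^ n / 2\<close>
  for \<open>y > 1\<close>.\<close>

lemma poly_chebyshev_joukowsky:
  assumes "y \<noteq> 0"
  shows "poly (chebyshev n) ((y + inverse y) / 2) = (y ^ n + inverse y ^ n) / 2"
proof (induction n rule: chebyshev.induct)
  case (3 n)
  \<comment> \<open>Abstract form of the recursion step, with \<open>z\<close> for
    \<open>inverse y\<close> and \<open>a\<close>, \<open>b\<close> for the powers, so that only
    \<open>y * z = 1\<close> is needed.\<close>
  have "(y + z) * (y * a + z * b) = y * (y * a) + z * (z * b) + (a + b)" if "y * z = 1" for z a b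
    using that by algebra
  then have "(y + inverse y) * (y ^ Suc n + inverse y ^ Suc n)
      = y ^ Suc (Suc n) + inverse y ^ Suc (Suc n) + (y ^ n + inverse y ^ n)"
    unfolding power_Suc using assms by simp
  then show ?case
    using 3 by (simp add: field_simps)
qed auto

text \<open>Move [a, b] onto [-1, 1] by an affine map \<open>l\<close> and normalise: the quotient
  of Chebyshev values at \<open>l x\<close> and \<open>l 0\<close> has numerator at most 1 on the
  interval, while \<open>l 0 > 1\<close> makes the denominator large.\<close>

lemma chebyshev_residual_polynomial:
  fixes a b :: real
  assumes "0 < a" "a \<le> b" "n > 0"
  obtains p where "degree p \<le> n" "poly p 0 = 1"
    "\<And>x. a \<le> x \<Longrightarrow> x \<le> b \<Longrightarrow>
      \<bar>poly p x\<bar> \<le> 2 * ((sqrt (b / a) - 1) / (sqrt (b / a) + 1)) ^ n"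
proof (cases "a = b")
  case True
  \<comment> \<open>The bound is \<open>0 ^ n = 0\<close> here, so the polynomial must vanish at
    \<open>a\<close>; 1 - x/a does.\<close>
  show thesis
  proof (rule that[of "[:1, - inverse a:]"])
    show "degree [:1, - inverse a:] \<le> n"
      using assms(3) by simp
  qed (use True assms in \<open>auto simp: field_simps\<close>)
next
  case False
  then have "a < b" using assms by simp
  define s where "s = sqrt (b / a)"
  have s: "s > 1" "s\<^sup>2 = b / a"
    using \<open>0 < a\<close> \<open>a < b\<close> by (auto simp: s_def)
  \<comment> \<open>Chosen so that (y + 1/y)/2 = (s^2 + 1)/(s^2 - 1) = \<open>poly l 0\<close>; its
    inverse is the convergence factor.\<close>
  define y where "y = (s + 1) / (s - 1)"
  have "y > 0" using s by (simp add: y_def)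
  \<comment> \<open>The affine map with l(a) = 1 and l(b) = -1.\<close>
  define l where "l = [:(b + a) / (b - a), - 2 / (b - a):]"
  have b: "b = a * s\<^sup>2"
    using s \<open>0 < a\<close> by simp
  have ba: "(b + a) / (b - a) = (s\<^sup>2 + 1) / (s\<^sup>2 - 1)"
  proof -
    have "(b + a) / (b - a) = (a * (s\<^sup>2 + 1)) / (a * (s\<^sup>2 - 1))"
      by (simp add: b algebra_simps)
    then show ?thesis using \<open>0 < a\<close> by simp
  qed
  have s21: "s\<^sup>2 - 1 = (s - 1) * (s + 1)"
    by (simp add: power2_eq_square algebra_simps)
  have l0: "poly l 0 = (y + inverse y) / 2"
    using s(1) unfolding l_def y_def
    by (simp add: ba s21) (simp add: divide_simps, simp add: power2_eq_square algebra_simps)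
  define c where "c = poly (chebyshev n) (poly l 0)"
  have c: "c \<ge> y ^ n / 2"
    using \<open>y > 0\<close> by (simp add: c_def l0 poly_chebyshev_joukowsky del: power_inverse)
  have "y ^ n > 0" using \<open>y > 0\<close> by simp
  then have "c > 0" using c by linarith
  show thesis
  proof (rule that[of "smult (inverse c) (chebyshev n \<circ>\<^sub>p l)"])
    have "degree (chebyshev n \<circ>\<^sub>p l) \<le> n * 1"
      unfolding degree_pcompose using degree_chebyshev_le[of n]
      by (intro mult_mono) (auto simp: l_def)
    then show "degree (smult (inverse c) (chebyshev n \<circ>\<^sub>p l)) \<le> n"
      using degree_smult_le order_trans by fastforce
    show "poly (smult (inverse c) (chebyshev n \<circ>\<^sub>p l)) 0 = 1"
      using \<open>c > 0\<close> by (simp add: poly_pcompose c_def)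
    fix x assume x: "a \<le> x" "x \<le> b"
    have "poly l x = (b + a - 2 * x) / (b - a)"
      by (simp add: l_def diff_divide_distrib)
    then have "\<bar>poly l x\<bar> \<le> 1"
      using x \<open>a < b\<close> by (simp add: abs_le_iff divide_le_eq le_divide_eq minus_divide_left)
    then have "\<bar>poly (chebyshev n) (poly l x)\<bar> \<le> 1"
      by (rule abs_poly_chebyshev_le_1)
    then have "\<bar>poly (smult (inverse c) (chebyshev n \<circ>\<^sub>p l)) x\<bar> \<le> inverse c"
      using \<open>c > 0\<close> by (simp add: poly_pcompose abs_mult mult_left_le)
    also have "inverse c \<le> inverse (y ^ n / 2)"
      using c \<open>y ^ n > 0\<close> by (intro le_imp_inverse_le) auto
    also have "\<dots> = 2 * ((s - 1) / (s + 1)) ^ n"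
      by (simp add: y_def power_divide)
    finally show "\<bar>poly (smult (inverse c) (chebyshev n \<circ>\<^sub>p l)) x\<bar>
        \<le> 2 * ((sqrt (b / a) - 1) / (sqrt (b / a) + 1)) ^ n"
      by (simp add: s_def)
  qed
qed

section \<open>Polynomials of a linear operator\<close>

definition poly_op :: "real poly \<Rightarrow> ('a::real_vector \<Rightarrow> 'a) \<Rightarrow> 'a \<Rightarrow> 'a" where
  "poly_op p T v = (\<Sum>i\<le>degree p. coeff p i *\<^sub>R (T ^^ i) v)"

lemma poly_op_0 [simp]: "poly_op 0 T v = 0"
  by (simp add: poly_op_def)

text \<open>Horner's rule, which turns the later facts about \<open>poly_op\<close> into inductions
  over \<open>pCons\<close>.\<close>

lemma poly_op_pCons:
  assumes "linear T"
  shows "poly_op (pCons a p) T v = a *\<^sub>R v + T (poly_op p T v)"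
\<comment> \<open>The degree grows by one under \<open>pCons\<close> only if \<open>p\<close> is
  nonzero.\<close>
proof (cases "p = 0")
  case True
  then show ?thesis
    using linear_0[OF assms] by (simp add: poly_op_def)
next
  case False
  then show ?thesis
    by (simp add: poly_op_def sum.atMost_Suc_shift linear_sum[OF assms] linear_cmul[OF assms]
        del: sum.atMost_Suc)
qed

lemma linear_poly_op:
  assumes "linear T"
  shows "linear (poly_op p T)"
proof (induction p)
  case 0
  then show ?case by (simp add: linear_iff)
next
  case (pCons a p)
  then show ?case
    using assms unfolding linear_iff
    by (simp add: poly_op_pCons[OF assms] algebra_simps)
qed

lemma poly_op_commute:
  assumes "linear T"
  shows "poly_op p T (T v) = T (poly_op p T v)"
  by (induction p)
    (use assms in \<open>simp_all add: poly_op_pCons linear_add linear_cmul linear_0\<close>)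

lemma poly_op_eigenvector:
  assumes "linear T" "T v = c *\<^sub>R v"
  shows "poly_op p T v = poly p c *\<^sub>R v"
  by (induction p)
    (use assms in \<open>simp_all add: poly_op_pCons linear_cmul algebra_simps\<close>)

section \<open>Self-adjoint operators for an energy inner product\<close>

locale energy_form =
  fixes G :: "'a::euclidean_space \<Rightarrow> 'a"
  assumes lin: "linear G"
    and sym: "G v \<bullet> w = v \<bullet> G w"
    and pos: "v \<noteq> 0 \<Longrightarrow> G v \<bullet> v > 0"
begin

lemma nonneg: "G v \<bullet> v \<ge> 0"
  using pos[of v] by (cases "v = 0") auto

definition self_adjoint :: "('a \<Rightarrow> 'a) \<Rightarrow> bool" where
  "self_adjoint T \<longleftrightarrow> linear T \<and> (\<forall>v w. G (T v) \<bullet> w = G v \<bullet> T w)"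

lemma self_adjoint_poly_op:
  assumes "self_adjoint T"
  shows "self_adjoint (poly_op p T)"
proof -
  have T: "linear T" "\<And>v w. G (T v) \<bullet> w = G v \<bullet> T w"
    using assms by (auto simp: self_adjoint_def)
  have "G (poly_op p T v) \<bullet> w = G v \<bullet> poly_op p T w" for v w
    by (induction p arbitrary: v w)
      (simp_all add: poly_op_pCons[OF T(1)] linear_0[OF lin] linear_add[OF lin]
        linear_cmul[OF lin] inner_add T(2) poly_op_commute[OF T(1), symmetric])
  then show ?thesis
    using linear_poly_op[OF T(1)] by (simp add: self_adjoint_def)
qed

text \<open>A maximizer of the Rayleigh quotient on the compact unit sphere of \<open>W\<close> is
  an eigenvector. The invariant subspace \<open>W\<close> is kept general so that eigenvectors can
  also be found inside an eigenspace of another operator.\<close>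

lemma rayleigh_maximizer:
  assumes T: "self_adjoint T" and W: "subspace W" "T ` W \<subseteq> W" and x: "x \<in> W" "x \<noteq> 0"
  obtains c w where "w \<in> W" "w \<noteq> 0" "T w = c *\<^sub>R w"
    "\<And>v. v \<in> W \<Longrightarrow> G (T v) \<bullet> v \<le> c * (G v \<bullet> v)"
proof -
  have lT: "linear T" and sa: "\<And>v w. G (T v) \<bullet> w = G v \<bullet> T w"
    using T by (auto simp: self_adjoint_def)
  let ?S = "sphere 0 1 \<inter> W"
  let ?q = "\<lambda>v. (G (T v) \<bullet> v) / (G v \<bullet> v)"
  have "compact ?S"
    using W(1) by (simp add: closed_subspace compact_Int_closed)
  moreover have "(1 / norm x) *\<^sub>R x \<in> ?S"
    using x W(1) by (simp add: subspace_scale)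
  moreover have "continuous_on ?S ?q"
  proof (intro continuous_intros)
    show "continuous_on ?S G" "continuous_on ?S (\<lambda>v. G (T v))"
      using lin lT linear_compose[OF lT lin]
      by (auto simp: o_def intro: linear_continuous_on linear_conv_bounded_linear[THEN iffD1])
    show "\<forall>v\<in>?S. G v \<bullet> v \<noteq> 0"
    proof
      fix v assume "v \<in> ?S"
      then have "v \<noteq> 0" by auto
      then show "G v \<bullet> v \<noteq> 0" using pos[of v] by simp
    qed
  qed
  ultimately obtain w where w: "w \<in> ?S" "\<And>v. v \<in> ?S \<Longrightarrow> ?q v \<le> ?q w"
    using continuous_attains_sup[of ?S ?q] by blast
  define c where "c = ?q w"
  have w0: "w \<noteq> 0" "w \<in> W" using w(1) by auto
  have max: "G (T v) \<bullet> v \<le> c * (G v \<bullet> v)" if "v \<in> W" for v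
  proof (cases "v = 0")
    case True
    then show ?thesis by simp
  next
    case False
    \<comment> \<open>The quotient is invariant under scaling, so the bound passes from the sphere
      to all of \<open>W\<close>.\<close>
    have "?q ((1 / norm v) *\<^sub>R v) \<le> c"
      unfolding c_def using False that W(1) by (intro w(2)) (simp add: subspace_scale)
    then have "?q v \<le> c"
      using False by (simp add: linear_cmul[OF lin] linear_cmul[OF lT])
    then show ?thesis
      using pos[OF False] by (simp add: pos_divide_le_eq)
  qed
  have eq: "G (T w) \<bullet> w = c * (G w \<bullet> w)"
    using pos[OF w0(1)] by (simp add: c_def)
  define D where "D v = c *\<^sub>R v - T v" for v
  have lD: "linear D"
    using lT unfolding D_def linear_iff by (simp add: algebra_simps)
  have saD: "G (D v) \<bullet> v' = G v \<bullet> D v'" for v v'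
    by (simp add: D_def linear_diff[OF lin] linear_cmul[OF lin] sa inner_diff)
  have D_nonneg: "G (D v) \<bullet> v \<ge> 0" if "v \<in> W" for v
    using max[OF that] by (simp add: D_def linear_diff[OF lin] linear_cmul[OF lin] inner_diff)
  have DW: "D v \<in> W" if "v \<in> W" for v
    using W that by (auto simp: D_def intro!: subspace_diff subspace_scale)
  \<comment> \<open>The form \<open>G (D v) \<bullet> v\<close> is nonnegative on \<open>W\<close> and vanishes at \<open>w\<close>. If \<open>D w \<noteq> 0\<close>, it would be
      negative at \<open>w - t *\<^sub>R D w\<close> for small \<open>t > 0\<close>, its linear term there being
      \<open>- 2 * t * (G (D w) \<bullet> D w)\<close>.\<close>
  have "D w = 0"
  proof (rule ccontr)
    assume "D w \<noteq> 0"
    define e where "e = G (D w) \<bullet> D w"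
    define h where "h = G (D (D w)) \<bullet> D w"
    have "e > 0" using pos[OF \<open>D w \<noteq> 0\<close>] by (simp add: e_def)
    have "h \<ge> 0" using D_nonneg[OF DW[OF w0(2)]] by (simp add: h_def)
    have *: "t * (t * h - 2 * e) \<ge> 0" for t
    proof -
      have "w - t *\<^sub>R D w \<in> W"
        using W(1) w0 DW by (auto intro!: subspace_diff subspace_scale)
      from D_nonneg[OF this] show ?thesis
        using eq
        by (simp add: linear_diff[OF lD] linear_cmul[OF lD] linear_diff[OF lin]
            linear_cmul[OF lin] inner_diff e_def h_def saD)
          (simp add: D_def linear_diff[OF lin] linear_cmul[OF lin] inner_diff sa algebra_simps)
    qed
    \<comment> \<open>The step size t = e/(h + 1) gives t h \<le> e < 2 e; the added 1 covers h =
      0.\<close>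
    have "e / (h + 1) > 0" using \<open>e > 0\<close> \<open>h \<ge> 0\<close> by simp
    then have "e / (h + 1) * h \<ge> 2 * e"
      using *[of "e / (h + 1)"] zero_le_mult_iff[of "e / (h + 1)" "e / (h + 1) * h - 2 * e"]
      by linarith
    moreover have "e / (h + 1) * h \<le> e"
      using \<open>e > 0\<close> \<open>h \<ge> 0\<close> by (simp add: field_simps)
    ultimately show False using \<open>e > 0\<close> by simp
  qed
  then have "T w = c *\<^sub>R w" by (simp add: D_def)
  with w0 max show thesis by (blast intro: that)
qed

lemma poly_op_energy_bound:
  assumes T: "self_adjoint T"
    and bound: "\<And>c w. w \<noteq> 0 \<Longrightarrow> T w = c *\<^sub>R w \<Longrightarrow> \<bar>poly p c\<bar> \<le> \<epsilon>"
  shows "G (poly_op p T v) \<bullet> poly_op p T v \<le> \<epsilon>\<^sup>2 * (G v \<bullet> v)"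
proof (cases "v = 0")
  case True
  then show ?thesis
    using T by (simp add: self_adjoint_def linear_poly_op linear_0)
next
  case False
  let ?S = "poly_op p T"
  let ?R = "\<lambda>v. ?S (?S v)"
  have lT: "linear T" using T by (simp add: self_adjoint_def)
  have lS: "linear ?S" by (rule linear_poly_op[OF lT])
  have saS: "G (?S v) \<bullet> w = G v \<bullet> ?S w" for v w
    using self_adjoint_poly_op[OF T] by (simp add: self_adjoint_def)
  have lR: "linear ?R" using linear_compose[OF lS lS] by (simp add: o_def)
  have "self_adjoint ?R" by (simp add: self_adjoint_def lR saS)
  then obtain s w where w: "w \<noteq> 0" "?R w = s *\<^sub>R w" "\<And>v. G (?R v) \<bullet> v \<le> s * (G v \<bullet> v)"
    by (rule rayleigh_maximizer[OF _ subspace_UNIV subset_UNIV UNIV_I False]) (rule that, auto)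
  define W where "W = {x. ?R x = s *\<^sub>R x}"
  have "subspace W"
    by (simp add: W_def subspace_def linear_0[OF lS] linear_add[OF lS] linear_cmul[OF lS]
        scaleR_add_right scaleR_left_commute)
  moreover have "T ` W \<subseteq> W"
    by (auto simp: W_def poly_op_commute[OF lT] linear_cmul[OF lT])
  moreover have "w \<in> W" using w by (simp add: W_def)
  ultimately obtain c x where x: "x \<in> W" "x \<noteq> 0" "T x = c *\<^sub>R x"
    using rayleigh_maximizer[OF T] w(1) by metis
  have "(poly p c)\<^sup>2 *\<^sub>R x = s *\<^sub>R x"
    using x(1) by (simp add: W_def poly_op_eigenvector[OF lT x(3)] linear_cmul[OF lS]
        power2_eq_square)
  then have "s = \<bar>poly p c\<bar>\<^sup>2" using x(2) by simp
  also have "\<dots> \<le> \<epsilon>\<^sup>2" using bound[OF x(2,3)] by (intro power_mono) auto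
  finally have "s * (G v \<bullet> v) \<le> \<epsilon>\<^sup>2 * (G v \<bullet> v)"
    by (rule mult_right_mono[OF _ nonneg])
  moreover have "G (?S v) \<bullet> ?S v = G (?R v) \<bullet> v"
    by (simp add: saS)
  ultimately show ?thesis using w(3)[of v] by simp
qed

lemma eigenvectors_orthogonal:
  assumes "self_adjoint T" "T v = c *\<^sub>R v" "T w = d *\<^sub>R w" "c \<noteq> d"
  shows "G v \<bullet> w = 0"
proof -
  have "G (T v) \<bullet> w = G v \<bullet> T w" using assms(1) by (simp add: self_adjoint_def)
  then show ?thesis using assms(2-4) by (simp add: linear_cmul[OF lin])
qed

text \<open>Eigenvectors for distinct eigenvalues are orthogonal, hence independent. Finiteness
  makes \<open>Max\<close> and \<open>Min\<close> in the condition number genuine extremes.\<close>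

lemma finite_spectrum:
  assumes T: "self_adjoint T"
  shows "finite {c. \<exists>v. v \<noteq> 0 \<and> T v = c *\<^sub>R v}"
proof -
  define E where "E = {c. \<exists>v. v \<noteq> 0 \<and> T v = c *\<^sub>R v}"
  have "\<forall>c\<in>E. \<exists>v. v \<noteq> 0 \<and> T v = c *\<^sub>R v" by (simp add: E_def)
  then obtain e where e: "\<And>c. c \<in> E \<Longrightarrow> e c \<noteq> 0 \<and> T (e c) = c *\<^sub>R e c"
    unfolding bchoice_iff by blast
  have inj: "inj_on e E"
  proof (rule inj_onI)
    fix c d assume "c \<in> E" "d \<in> E" "e c = e d"
    then have "c *\<^sub>R e c = d *\<^sub>R e c" "e c \<noteq> 0" using e[of c] e[of d] by metis+
    then show "c = d" by simp
  qed
  have "independent (e ` E)"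
    unfolding independent_explicit_finite_subsets
  proof (intro allI impI ballI)
    fix S r v
    assume S: "S \<subseteq> e ` E" "finite S" and sum0: "(\<Sum>v\<in>S. r v *\<^sub>R v) = 0" and v: "v \<in> S"
    obtain c where c: "c \<in> E" "v = e c" using S v by auto
    have "G w \<bullet> v = 0" if "w \<in> S - {v}" for w
    proof -
      obtain d where d: "d \<in> E" "w = e d" using S(1) \<open>w \<in> S - {v}\<close> by blast
      then show ?thesis
        using e[OF c(1)] e[OF d(1)] c(2) that by (intro eigenvectors_orthogonal[OF T, of _ d _ c]) auto
    qed
    \<comment> \<open>Pairing the vanishing combination with \<open>v\<close> isolates the
      coefficient of \<open>v\<close>.\<close>
    then have "(\<Sum>w\<in>S. r w * (G w \<bullet> v)) = r v * (G v \<bullet> v)"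
      using S(2) v by (subst sum.remove[of _ v]) auto
    moreover have "(\<Sum>w\<in>S. r w * (G w \<bullet> v)) = G (\<Sum>w\<in>S. r w *\<^sub>R w) \<bullet> v"
      by (simp add: linear_sum[OF lin] linear_cmul[OF lin] inner_sum_left)
    ultimately have "r v * (G v \<bullet> v) = 0"
      using sum0 by (simp add: linear_0[OF lin])
    then show "r v = 0" using pos[of v] e[OF c(1)] c(2) by auto
  qed
  then have "finite (e ` E)" by (rule independent_imp_finite)
  then have "finite E" using inj by (rule finite_imageD)
  then show ?thesis by (simp add: E_def)
qed

lemma spectrum_nonempty:
  assumes T: "self_adjoint T"
  shows "{c. \<exists>v. v \<noteq> 0 \<and> T v = c *\<^sub>R v} \<noteq> {}"
proof -
  obtain b :: 'a where "b \<in> Basis" using nonempty_Basis by blast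
  then have "b \<noteq> 0" by (rule nonzero_Basis)
  then show ?thesis
    by (rule rayleigh_maximizer[OF T subspace_UNIV subset_UNIV UNIV_I]) blast
qed

end

section \<open>The preconditioned operator\<close>

lemma spd_inner_sym:
  assumes "spd C"
  shows "(C *v v) \<bullet> w = v \<bullet> (C *v w)"
  using assms dot_lmul_matrix[of v C w] transpose_matrix_vector[of C v]
  by (simp add: spd_def symmetric_def)

lemma energy_form_spd: "spd C \<Longrightarrow> energy_form ((*v) C)"
  by (rule energy_form.intro) (auto simp: spd_inner_sym, auto simp: spd_def inner_commute)

lemma invertible_spd:
  fixes C :: "real^'n^'n"
  assumes "spd C"
  shows "invertible C"
proof -
  have "x = 0" if "C *v x = 0" for x
    using assms that unfolding spd_def by (metis inner_zero_left less_irrefl)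
  then show ?thesis
    by (simp add: invertible_left_inverse matrix_left_invertible_ker)
qed

lemma
  assumes "spd C"
  shows matrix_inv_mult_vector_spd: "matrix_inv C *v (C *v v) = v"
    and mult_matrix_inv_vector_spd: "C *v (matrix_inv C *v v) = v"
proof -
  have "C ** matrix_inv C = mat 1 \<and> matrix_inv C ** C = mat 1"
    using invertible_spd[OF assms] unfolding invertible_def matrix_inv_def by (rule someI_ex)
  then show "matrix_inv C *v (C *v v) = v" "C *v (matrix_inv C *v v) = v"
    by (simp_all add: matrix_vector_mul_assoc)
qed

lemma spd_matrix_inv:
  assumes "spd C"
  shows "spd (matrix_inv C)"
proof -
  let ?B = "matrix_inv C"
  have sym: "(?B *v v) \<bullet> w = v \<bullet> (?B *v w)" for v w
    using spd_inner_sym[OF assms, of "?B *v v" "?B *v w"]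
    by (simp add: mult_matrix_inv_vector_spd[OF assms])
  have "(transpose ?B *v v) \<bullet> w = (?B *v v) \<bullet> w" for v w
    by (simp add: sym dot_lmul_matrix)
  then have "transpose ?B = ?B"
    unfolding matrix_eq by (metis vector_eq_rdot)
  moreover have "(?B *v v) \<bullet> v > 0" if "v \<noteq> 0" for v
  proof -
    have "?B *v v \<noteq> 0"
      using that mult_matrix_inv_vector_spd[OF assms, of v] by auto
    then have "(C *v (?B *v v)) \<bullet> (?B *v v) > 0"
      using assms by (simp add: spd_def)
    then show ?thesis
      by (simp add: mult_matrix_inv_vector_spd[OF assms] inner_commute)
  qed
  ultimately show ?thesis by (simp add: spd_def symmetric_def)
qed

text \<open>The product C B C is symmetric.\<close>

lemma self_adjoint_preconditioned:
  assumes "spd C" "spd B"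
  shows "energy_form.self_adjoint ((*v) C) ((*v) (B ** C))"
proof -
  interpret energy_form "(*v) C" by (rule energy_form_spd[OF assms(1)])
  show ?thesis
    by (simp add: self_adjoint_def matrix_vector_mul_assoc[symmetric]
        spd_inner_sym[OF assms(1)] spd_inner_sym[OF assms(2)])
qed

text \<open>An eigenpair solves C v = c C0 v, so c is a quotient of two positive energies.\<close>

lemma eigenvalues_preconditioned_pos:
  assumes "spd C" "spd C0" "c \<in> eigenvalues (matrix_inv C0 ** C)"
  shows "c > 0"
proof -
  obtain v where v: "v \<noteq> 0" "matrix_inv C0 *v (C *v v) = c *\<^sub>R v"
    using assms(3) by (auto simp: eigenvalues_def matrix_vector_mul_assoc)
  then have "C *v v = c *\<^sub>R (C0 *v v)"
    by (metis matrix_vector_mult_scaleR mult_matrix_inv_vector_spd[OF assms(2)])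
  then have "(C *v v) \<bullet> v = c * ((C0 *v v) \<bullet> v)" by simp
  moreover have "(C *v v) \<bullet> v > 0" "(C0 *v v) \<bullet> v > 0"
    using assms(1,2) v(1) by (auto simp: spd_def)
  ultimately show ?thesis by (metis zero_less_mult_pos2)
qed

section \<open>The offline space\<close>

lemma precond_resid_pcg: "precond_resid (pcg M B f k) = B *v resid (pcg M B f k)"
  by (cases k) (simp_all add: pcg_step_def Let_def)

lemma direction_eq_0_if_resid_eq_0:
  assumes "resid (pcg M B f k) = 0"
  shows "direction (pcg M B f k) = 0"
  using assms precond_resid_pcg[of M B f k]
  by (cases k) (simp_all add: pcg_step_def Let_def)

lemma reduced_space_mono: "i \<le> j \<Longrightarrow> reduced_space M B f i \<subseteq> reduced_space M B f j"
  unfolding reduced_space_def by (intro span_mono image_mono) auto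

lemma subspace_reduced_space: "subspace (reduced_space M B f d)"
  by (simp add: reduced_space_def)

lemma direction_in_reduced_space: "k < d \<Longrightarrow> direction (pcg M B f k) \<in> reduced_space M B f d"
  unfolding reduced_space_def by (intro span_base) auto

text \<open>The direction update read backwards: z_k = p_k - c p_{k-1} for some scalar c.\<close>

lemma precond_resid_in_reduced_space:
  assumes "k < d"
  shows "precond_resid (pcg M B f k) \<in> reduced_space M B f d"
proof (cases k)
  case 0
  then show ?thesis using direction_in_reduced_space[OF assms] by simp
next
  case (Suc j)
  have "\<exists>c. direction (pcg M B f k)
      = precond_resid (pcg M B f k) + c *\<^sub>R direction (pcg M B f j)"
    unfolding Suc pcg.simps pcg_step_def Let_def cg_state.simps by (rule exI) (rule refl)
  then obtain c where "direction (pcg M B f k)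
      = precond_resid (pcg M B f k) + c *\<^sub>R direction (pcg M B f j)"
    by blast
  then have "precond_resid (pcg M B f k)
      = direction (pcg M B f k) - c *\<^sub>R direction (pcg M B f j)"
    by simp
  then show ?thesis
    using direction_in_reduced_space[of k d] direction_in_reduced_space[of j d] assms Suc
    by (auto intro!: subspace_diff subspace_scale subspace_reduced_space)
qed

text \<open>The residual update gives z_{k+1} = z_k - \<alpha> B M p_k. Nonzero directions force
  \<alpha> to be nonzero, so B M p_k is a combination of z_k and z_{k+1}.\<close>

lemma reduced_space_step:
  assumes "spd M" "spd B" "pcg_well_defined M B f m" "d < m" "v \<in> reduced_space M B f d"
  shows "B *v (M *v v) \<in> reduced_space M B f (Suc d)"
proof -
  have "B *v (M *v direction (pcg M B f k)) \<in> reduced_space M B f (Suc d)" if "k < d" for k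
  proof -
    let ?s = "pcg M B f k"
    have p: "direction ?s \<noteq> 0" using assms that by (auto simp: pcg_well_defined_def)
    then have r: "resid ?s \<noteq> 0" using direction_eq_0_if_resid_eq_0 by blast
    define \<alpha> where "\<alpha> = (resid ?s \<bullet> precond_resid ?s) / ((M *v direction ?s) \<bullet> direction ?s)"
    have "(B *v resid ?s) \<bullet> resid ?s > 0" "(M *v direction ?s) \<bullet> direction ?s > 0"
      using assms(1,2) p r by (auto simp: spd_def)
    then have "\<alpha> \<noteq> 0"
      by (simp add: \<alpha>_def precond_resid_pcg inner_commute)
    have "precond_resid (pcg M B f (Suc k))
        = precond_resid ?s - \<alpha> *\<^sub>R (B *v (M *v direction ?s))"
      by (simp add: pcg_step_def Let_def \<alpha>_def precond_resid_pcg matrix_vector_mult_diff_distrib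
          matrix_vector_mult_scaleR)
    then have "B *v (M *v direction ?s)
        = (1 / \<alpha>) *\<^sub>R (precond_resid ?s - precond_resid (pcg M B f (Suc k)))"
      using \<open>\<alpha> \<noteq> 0\<close> by simp
    then show ?thesis
      using precond_resid_in_reduced_space[of k "Suc d"]
        precond_resid_in_reduced_space[of "Suc k" "Suc d"] that
      by (auto intro!: subspace_diff subspace_scale subspace_reduced_space)
  qed
  then have "(\<lambda>v. B *v (M *v v)) ` (\<lambda>k. direction (pcg M B f k)) ` {..<d}
      \<subseteq> reduced_space M B f (Suc d)"
    by auto
  then have "span ((\<lambda>v. B *v (M *v v)) ` (\<lambda>k. direction (pcg M B f k)) ` {..<d})
      \<subseteq> reduced_space M B f (Suc d)"
    by (rule span_minimal) (rule subspace_reduced_space)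
  moreover have "linear (\<lambda>v. B *v (M *v v))"
    by (simp add: matrix_vector_mul_assoc)
  ultimately show ?thesis
    using assms(5) by (auto simp: reduced_space_def linear_span_image)
qed

text \<open>\<open>T\<close> is arbitrary because the directions come from the parameter \<mu>1
  while the polynomial is taken in the operator for \<mu>.\<close>

lemma poly_op_in_reduced_space:
  assumes T: "linear T"
    and step: "\<And>d v. d < m \<Longrightarrow> v \<in> reduced_space M B f d \<Longrightarrow> T v \<in> reduced_space M B f (Suc d)"
    and "degree q < d" "d \<le> m"
  shows "poly_op q T (B *v f) \<in> reduced_space M B f d"
  using assms(3,4)
proof (induction q arbitrary: d)
  case 0
  then show ?case by (simp add: subspace_0 subspace_reduced_space)
next
  case (pCons a q)
  then obtain d' where d: "d = Suc d'" by (cases d) auto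
  have "poly_op q T (B *v f) \<in> reduced_space M B f d'"
  \<comment> \<open>With \<open>q = 0\<close> and \<open>d' = 0\<close> the degree condition of the
    induction hypothesis fails, but the zero vector lies in every space.\<close>
  proof (cases "q = 0")
    case True
    then show ?thesis by (simp add: subspace_0 subspace_reduced_space)
  next
    case False
    then show ?thesis using pCons d by (intro pCons.IH) auto
  qed
  then have "T (poly_op q T (B *v f)) \<in> reduced_space M B f d"
    using step pCons.prems d by simp
  moreover have "B *v f \<in> reduced_space M B f d"
    using direction_in_reduced_space[of 0 d M B f] d by simp
  ultimately show ?case
    by (simp add: poly_op_pCons[OF T] subspace_add subspace_scale subspace_reduced_space)
qed

text \<open>Galerkin orthogonality of \<open>u - w\<close> to \<open>w - v\<close>, followed by
  Pythagoras in the energy inner product.\<close>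

lemma galerkin_best_approximation:
  assumes C: "spd C" and K: "subspace K" and w: "galerkin_solution C (C *v u) K w" and v: "v \<in> K"
  shows "energy_norm C (u - w) \<le> energy_norm C (u - v)"
proof -
  interpret energy_form "(*v) C" by (rule energy_form_spd[OF C])
  have "w - v \<in> K" using w v K by (auto simp: galerkin_solution_def intro: subspace_diff)
  then have orth: "(C *v (u - w)) \<bullet> (w - v) = 0"
    using w by (simp add: galerkin_solution_def matrix_vector_mult_diff_distrib inner_diff_left)
  then have orth': "(C *v (w - v)) \<bullet> (u - w) = 0"
    by (metis sym inner_commute)
  have "(C *v (x + y)) \<bullet> (x + y) = (C *v x) \<bullet> x + (C *v y) \<bullet> y"
    if "(C *v x) \<bullet> y = 0" "(C *v y) \<bullet> x = 0" for x y
    using that by (simp add: matrix_vector_right_distrib inner_add)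
  from this[OF orth orth']
  have "(C *v (u - v)) \<bullet> (u - v) = (C *v (u - w)) \<bullet> (u - w) + (C *v (w - v)) \<bullet> (w - v)"
    by simp
  then show ?thesis
    using nonneg[of "w - v"] by (simp add: energy_norm_def)
qed

theorem theorem2p3:
  fixes A1 A2 :: "real^'n^'n"
    and P :: "(real^'d) set"
    and \<theta>1 \<theta>2 :: "real^'d \<Rightarrow> real"
    and A :: "real^'d \<Rightarrow> real^'n^'n"
    and f :: "real^'n"
    and u :: "real^'d \<Rightarrow> real^'n"
    and \<mu>0 \<mu>1 \<mu> :: "real^'d"
    and B :: "real^'n^'n"
    and \<kappa> :: "real^'d \<Rightarrow> real"
    and m :: nat
  assumes "symmetric A1" and "symmetric A2"
    and "compact P"
    and "\<And>\<nu>. \<nu> \<in> P \<Longrightarrow> A \<nu> = \<theta>1 \<nu> *\<^sub>R A1 + \<theta>2 \<nu> *\<^sub>R A2"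
    and "\<And>\<nu>. \<nu> \<in> P \<Longrightarrow> spd (A \<nu>)"
    and "\<And>\<nu>. \<nu> \<in> P \<Longrightarrow> A \<nu> *v u \<nu> = f"
    and "\<mu>0 \<in> P" and "\<mu>1 \<in> P"
    and "B = matrix_inv (A \<mu>0)"
    and "\<And>\<nu>. \<nu> \<in> P \<Longrightarrow> \<kappa> \<nu> = condition_number (B ** A \<nu>)"
    and "m > 0"
    and "pcg_well_defined (A \<mu>1) B f m"
    and "\<theta>1 \<mu>0 * \<theta>2 \<mu>1 - \<theta>2 \<mu>0 * \<theta>1 \<mu>1 \<noteq> 0"
    and "\<mu> \<in> P"
    and "\<theta>1 \<mu>0 * \<theta>2 \<mu> - \<theta>2 \<mu>0 * \<theta>1 \<mu> \<noteq> 0"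
  shows "energy_norm (A \<mu>) (u \<mu> - rcgbm A f B \<mu>1 m \<mu>)
    \<le> 2 * ((sqrt (\<kappa> \<mu>) - 1) / (sqrt (\<kappa> \<mu>) + 1)) ^ m * energy_norm (A \<mu>) (u \<mu>)"
proof -
  let ?C = "A \<mu>" and ?K = "reduced_space (A \<mu>1) B f m"
  let ?T = "(*v) (B ** ?C)"
  have C: "spd ?C" and C0: "spd (A \<mu>0)" and C1: "spd (A \<mu>1)"
    using assms by auto
  have B: "spd B" using spd_matrix_inv[OF C0] assms(9) by simp
  interpret energy_form "(*v) ?C" by (rule energy_form_spd[OF C])
  have T: "self_adjoint ?T" by (rule self_adjoint_preconditioned[OF C B])

  define \<Delta> where "\<Delta> = \<theta>1 \<mu>0 * \<theta>2 \<mu>1 - \<theta>2 \<mu>0 * \<theta>1 \<mu>1"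
  have \<Delta>: "\<Delta> \<noteq> 0" using assms(13) by (simp add: \<Delta>_def)
  \<comment> \<open>Cramer's rule for the coordinates of \<open>A \<mu>\<close> with respect to \<open>A \<mu>0\<close> and \<open>A \<mu>1\<close>\<close>
  define a where "a = (\<theta>1 \<mu> * \<theta>2 \<mu>1 - \<theta>2 \<mu> * \<theta>1 \<mu>1) / \<Delta>"
  define b where "b = (\<theta>1 \<mu>0 * \<theta>2 \<mu> - \<theta>2 \<mu>0 * \<theta>1 \<mu>) / \<Delta>"
  have "a * \<theta>1 \<mu>0 + b * \<theta>1 \<mu>1 = \<theta>1 \<mu> * \<Delta> / \<Delta>" "a * \<theta>2 \<mu>0 + b * \<theta>2 \<mu>1 = \<theta>2 \<mu> * \<Delta> / \<Delta>"
    unfolding a_def b_def times_divide_eq_left add_divide_distrib[symmetric]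
    by (simp_all add: \<Delta>_def algebra_simps)
  then have ab: "\<theta>1 \<mu> = a * \<theta>1 \<mu>0 + b * \<theta>1 \<mu>1" "\<theta>2 \<mu> = a * \<theta>2 \<mu>0 + b * \<theta>2 \<mu>1"
    using \<Delta> by simp_all
  have "?C = a *\<^sub>R A \<mu>0 + b *\<^sub>R A \<mu>1"
    using assms(4)[OF assms(7)] assms(4)[OF assms(8)] assms(4)[OF assms(14)]
    by (simp add: ab algebra_simps)
  then have Tv: "?T v = a *\<^sub>R v + b *\<^sub>R (B *v (A \<mu>1 *v v))" for v
    using matrix_inv_mult_vector_spd[OF C0, of v] assms(9)
    by (simp add: matrix_vector_mul_assoc[symmetric] matrix_vector_mult_add_rdistrib
        scaleR_matrix_vector_assoc[symmetric] matrix_vector_right_distrib matrix_vector_mult_scaleR)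
  have step: "?T v \<in> reduced_space (A \<mu>1) B f (Suc d)"
    if "d < m" "v \<in> reduced_space (A \<mu>1) B f d" for d v
    unfolding Tv
    using reduced_space_step[OF C1 B assms(12) that] that(2)
      reduced_space_mono[of d "Suc d" "A \<mu>1" B f]
    by (intro subspace_add subspace_scale subspace_reduced_space) auto

  define E where "E = eigenvalues (B ** ?C)"
  have E: "finite E" "E \<noteq> {}"
    using finite_spectrum[OF T] spectrum_nonempty[OF T] by (simp_all add: E_def eigenvalues_def)
  have "Min E > 0"
    using eigenvalues_preconditioned_pos[OF C C0] E assms(9) by (simp add: E_def)
  moreover have "Min E \<le> Max E" using E by simp
  moreover note assms(11)
  moreover have \<kappa>: "\<kappa> \<mu> = Max E / Min E"
    using assms(10)[OF assms(14)] by (simp add: condition_number_def E_def)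
  define \<epsilon> where "\<epsilon> = 2 * ((sqrt (\<kappa> \<mu>) - 1) / (sqrt (\<kappa> \<mu>) + 1)) ^ m"
  ultimately obtain p where p: "degree p \<le> m" "poly p 0 = 1"
    "\<And>x. Min E \<le> x \<Longrightarrow> x \<le> Max E \<Longrightarrow> \<bar>poly p x\<bar> \<le> \<epsilon>"
    by (metis chebyshev_residual_polynomial \<kappa> \<epsilon>_def)
  have bound: "\<bar>poly p c\<bar> \<le> \<epsilon>" if "v \<noteq> 0" "?T v = c *\<^sub>R v" for c v
  proof -
    have "c \<in> E" using that by (auto simp: E_def eigenvalues_def)
    then show ?thesis using E(1) by (intro p(3)) auto
  qed
  \<comment> \<open>Read off from a bounded absolute value; it lets \<epsilon> leave the square root
    at the end.\<close>
  have "\<epsilon> \<ge> 0"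
    using p(3)[of "Min E"] \<open>Min E \<le> Max E\<close> by simp

  \<comment> \<open>Since p(0) = 1, p(x) = 1 + x q(x) with q of degree below m.\<close>
  obtain q where q: "p = pCons 1 q"
    using p(2) by (cases p) auto
  have "degree q < m"
    using p(1) assms(11) by (cases "q = 0") (auto simp: q)
  \<comment> \<open>The competitor -q(T) B f: since B f = T u, its error is u + q(T) T u = p(T)
    u.\<close>
  then have v: "- poly_op q ?T (B *v f) \<in> ?K"
    using poly_op_in_reduced_space[OF _ step] by (simp add: subspace_neg subspace_reduced_space)
  have fu: "f = ?C *v u \<mu>" using assms(6)[OF assms(14)] by simp
  have err: "u \<mu> - - poly_op q ?T (B *v f) = poly_op p ?T (u \<mu>)"
    using poly_op_commute[of ?T q "u \<mu>"]
    by (simp add: q poly_op_pCons fu matrix_vector_mul_assoc)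
  have "galerkin_solution ?C f ?K (rcgbm A f B \<mu>1 m \<mu>)"
    unfolding rcgbm_def
    by (rule theI'[OF galerkin_solution_ex1[OF C subspace_reduced_space]])
  then have "energy_norm ?C (u \<mu> - rcgbm A f B \<mu>1 m \<mu>) \<le> energy_norm ?C (poly_op p ?T (u \<mu>))"
    using galerkin_best_approximation[OF C subspace_reduced_space _ v] err fu by metis
  also have "\<dots> \<le> sqrt (\<epsilon>\<^sup>2 * ((?C *v u \<mu>) \<bullet> u \<mu>))"
    unfolding energy_norm_def
    by (intro real_sqrt_le_mono poly_op_energy_bound[OF T] bound)
  also have "\<dots> = \<epsilon> * energy_norm ?C (u \<mu>)"
    using \<open>\<epsilon> \<ge> 0\<close> by (simp add: energy_norm_def real_sqrt_mult)
  finally show ?thesis by (simp add: \<epsilon>_def)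
qed

end
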